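(* Let $k,r$ be positive integers. Then $\mathcal{P}^{(r,1)}(t)^k=\mathcal{P}^{(r,k)}(t)$.
   Context: For positive integers $r,k$, an $(r,k)$-parking function of length $n$ is a sequence $(a_1,\dots,a_n)$ of positive integers whose increasing rearrangement $b_1\le\cdots\le b_n$ satisfies $b_i\le k+(i-1)r$ for all $i$. $F_n^{(r,k)}$ is the Frobenius characteristic of the action of $\mathfrak{S}_n$ on the set of $(r,k)$-parking functions of length $n$ by permuting coordinates (a homogeneous symmetric function of degree $n$), with $F_0^{(r,k)}=1$. Define $\mathcal{P}^{(r,k)}(t)=\sum_{n\ge0}F_n^{(r,k)}t^n$. *)

theory Defs
  imports
    "HOL-Library.Multiset"
    "HOL-Combinatorics.Permutations"
    "HOL-Combinatorics.Orbits"
    "HOL-Computational_Algebra.Formal_Power_Series"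
begin

section \<open>The ring of symmetric functions over the rationals\<close>

text \<open>
  Monomials in the variables \<open>x\<^sub>0, x\<^sub>1, x\<^sub>2, \<dots>\<close> are encoded as finite multisets of indices, so that
  \<^term>\<open>count m i\<close> is the exponent of the variable number \<open>i\<close>, \<^term>\<open>size m\<close> is the degree, and
  the product of monomials is multiset sum. A symmetric function is a formal power series
  of bounded degree, given by its coefficients, that is invariant under permuting the variables.
\<close>

typedef sym_fun =
  "{f :: nat multiset \<Rightarrow> rat.
      (\<exists>d. \<forall>m. f m \<noteq> 0 \<longrightarrow> size m \<le> d) \<and>
      (\<forall>\<pi> m. bij \<pi> \<longrightarrow> f (image_mset \<pi> m) = f m)}"
  morphisms sf_coeff Abs_sym_fun
  by (rule exI[of _ "\<lambda>_. 0"]) auto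

setup_lifting type_definition_sym_fun

lemma finite_mset_splits: "finite {(a, b). a + b = (m :: 'a multiset)}"
proof -
  have "finite {a. a \<subseteq># m}"
  proof (rule finite_subset)
    show "{a. a \<subseteq># m} \<subseteq> {a. set_mset a \<subseteq> set_mset m \<and> size a \<le> size m}"
      by (auto simp: size_mset_mono dest: set_mset_mono)
    have "{a. set_mset a \<subseteq> set_mset m \<and> size a \<le> size m} \<subseteq>
            mset ` {xs. set xs \<subseteq> set_mset m \<and> length xs \<le> size m}"
    proof
      fix a assume "a \<in> {a. set_mset a \<subseteq> set_mset m \<and> size a \<le> size m}"
      moreover obtain xs where "a = mset xs" using ex_mset by metis
      ultimately show "a \<in> mset ` {xs. set xs \<subseteq> set_mset m \<and> length xs \<le> size m}" by auto
    qed
    then show "finite {a. set_mset a \<subseteq> set_mset m \<and> size a \<le> size m}"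
      by (rule finite_subset) (auto intro: finite_lists_length_le)
  qed
  moreover have "{(a, b). a + b = m} \<subseteq> {a. a \<subseteq># m} \<times> {a. a \<subseteq># m}"
    by auto
  ultimately show ?thesis by (meson finite_SigmaI finite_subset)
qed

definition conv_mset :: "('a multiset \<Rightarrow> 'b::comm_ring_1) \<Rightarrow> ('a multiset \<Rightarrow> 'b) \<Rightarrow> 'a multiset \<Rightarrow> 'b" where
  "conv_mset f g m = (\<Sum>(a, b) \<in> {(a, b). a + b = m}. f a * g b)"

lemma conv_mset_commute: "conv_mset f g = conv_mset g f"
proof
  fix m
  show "conv_mset f g m = conv_mset g f m"
    unfolding conv_mset_def
    by (rule sum.reindex_bij_witness[of _ prod.swap prod.swap]) (auto simp: add.commute mult.commute)
qed

lemma conv_mset_assoc: "conv_mset (conv_mset f g) h = conv_mset f (conv_mset g h)"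
proof
  fix m
  have "conv_mset (conv_mset f g) h m =
      (\<Sum>x\<in>{(a, b). a + b = m}. \<Sum>y\<in>{(c, d). c + d = fst x}. f (fst y) * g (snd y) * h (snd x))"
    unfolding conv_mset_def by (auto simp: sum_distrib_right case_prod_beta)
  also have "\<dots> = (\<Sum>(x, y)\<in>(SIGMA x:{(a, b). a + b = m}. {(c, d). c + d = fst x}).
      f (fst y) * g (snd y) * h (snd x))"
    by (rule sum.Sigma) (use finite_mset_splits in auto)
  also have "\<dots> = (\<Sum>(x, y)\<in>(SIGMA x:{(a, b). a + b = m}. {(c, d). c + d = snd x}).
      f (fst x) * (g (fst y) * h (snd y)))"
    by (rule sum.reindex_bij_witness
        [of _ "\<lambda>((a, b), (c, d)). ((a + c, d), (a, c))" "\<lambda>((a, b), (c, d)). ((c, d + b), (d, b))"])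
       (auto simp: algebra_simps)
  also have "\<dots> = (\<Sum>x\<in>{(a, b). a + b = m}. \<Sum>y\<in>{(c, d). c + d = snd x}.
      f (fst x) * (g (fst y) * h (snd y)))"
    by (rule sum.Sigma[symmetric]) (use finite_mset_splits in auto)
  also have "\<dots> = conv_mset f (conv_mset g h) m"
    unfolding conv_mset_def by (auto simp: sum_distrib_left case_prod_beta)
  finally show "conv_mset (conv_mset f g) h m = conv_mset f (conv_mset g h) m" .
qed

lemma conv_mset_one:
  fixes f :: "'a multiset \<Rightarrow> 'b::comm_ring_1"
  shows "conv_mset (\<lambda>m. if m = {#} then 1 else 0) f = f"
proof
  fix m
  have "conv_mset (\<lambda>m. if m = {#} then 1 else 0) f m =
      (\<Sum>(a, b) \<in> {({#} :: 'a multiset, m)}. (if a = {#} then 1 else 0) * f b)"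
    unfolding conv_mset_def by (rule sum.mono_neutral_right) (auto simp: finite_mset_splits split: if_splits)
  then show "conv_mset (\<lambda>m. if m = {#} then 1 else 0) f m = f m" by simp
qed

lemma conv_mset_distrib:
  "conv_mset (\<lambda>m. f m + g m) h = (\<lambda>m. conv_mset f h m + conv_mset g h m)"
  by (rule ext) (simp add: conv_mset_def sum.distrib[symmetric] algebra_simps case_prod_beta)

lemma conv_mset_bounded:
  assumes "\<forall>m. f m \<noteq> 0 \<longrightarrow> size m \<le> d" "\<forall>m. g m \<noteq> 0 \<longrightarrow> size m \<le> e"
    "conv_mset f g m \<noteq> 0"
  shows "size m \<le> d + e"
proof -
  obtain a b where "a + b = m" "f a * g b \<noteq> 0"
    using assms(3) unfolding conv_mset_def by (auto elim!: sum.not_neutral_contains_not_neutral)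
  then have "f a \<noteq> 0" "g b \<noteq> 0" by auto
  then have "size a \<le> d" "size b \<le> e" using assms(1,2) by auto
  then show ?thesis using \<open>a + b = m\<close> by auto
qed

lemma conv_mset_symmetric:
  assumes "\<forall>\<pi> m. bij \<pi> \<longrightarrow> f (image_mset \<pi> m) = f m"
    "\<forall>\<pi> m. bij \<pi> \<longrightarrow> g (image_mset \<pi> m) = g m" "bij \<pi>"
  shows "conv_mset f g (image_mset \<pi> m) = conv_mset f g m"
proof -
  have inv: "bij (inv \<pi>)" "\<pi> \<circ> inv \<pi> = id" "inv \<pi> \<circ> \<pi> = id"
    using assms(3) by (simp_all add: bij_imp_bij_inv bij_is_inj bij_is_surj surj_iff[symmetric] inj_iff[symmetric])
  have im: "image_mset \<pi> (image_mset (inv \<pi>) a) = a" "image_mset (inv \<pi>) (image_mset \<pi> a) = a" for a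
    using inv by (metis image_mset.comp image_mset.id id_apply comp_apply)+
  show ?thesis unfolding conv_mset_def
    by (rule sum.reindex_bij_witness
        [of _ "map_prod (image_mset \<pi>) (image_mset \<pi>)" "map_prod (image_mset (inv \<pi>)) (image_mset (inv \<pi>))"])
       (use assms(1,2) inv(1) in \<open>auto simp: im simp flip: image_mset_union\<close>)
qed

instantiation sym_fun :: comm_ring_1
begin

lift_definition zero_sym_fun :: sym_fun is "\<lambda>_. 0" by auto

lift_definition one_sym_fun :: sym_fun is "\<lambda>m. if m = {#} then 1 else 0" by auto

lift_definition plus_sym_fun :: "sym_fun \<Rightarrow> sym_fun \<Rightarrow> sym_fun" is "\<lambda>f g m. f m + g m"
proof (intro CollectI conjI)
  fix f g :: "nat multiset \<Rightarrow> rat"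
  assume f: "(\<exists>d. \<forall>m. f m \<noteq> 0 \<longrightarrow> size m \<le> d) \<and> (\<forall>\<pi> m. bij \<pi> \<longrightarrow> f (image_mset \<pi> m) = f m)"
    and g: "(\<exists>d. \<forall>m. g m \<noteq> 0 \<longrightarrow> size m \<le> d) \<and> (\<forall>\<pi> m. bij \<pi> \<longrightarrow> g (image_mset \<pi> m) = g m)"
  obtain d e where "\<forall>m. f m \<noteq> 0 \<longrightarrow> size m \<le> d" "\<forall>m. g m \<noteq> 0 \<longrightarrow> size m \<le> e"
    using f g by auto
  then have "\<forall>m. f m + g m \<noteq> 0 \<longrightarrow> size m \<le> max d e"
    by (metis add.right_neutral le_max_iff_disj)
  then show "\<exists>d. \<forall>m. f m + g m \<noteq> 0 \<longrightarrow> size m \<le> d" ..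
  show "\<forall>\<pi> m. bij \<pi> \<longrightarrow> f (image_mset \<pi> m) + g (image_mset \<pi> m) = f m + g m"
    using f g by simp
qed

lift_definition uminus_sym_fun :: "sym_fun \<Rightarrow> sym_fun" is "\<lambda>f m. - f m" by auto

definition minus_sym_fun :: "sym_fun \<Rightarrow> sym_fun \<Rightarrow> sym_fun" where
  "minus_sym_fun f g = f + (- g)"

lift_definition times_sym_fun :: "sym_fun \<Rightarrow> sym_fun \<Rightarrow> sym_fun" is conv_mset
proof (intro CollectI conjI)
  fix f g :: "nat multiset \<Rightarrow> rat"
  assume f: "(\<exists>d. \<forall>m. f m \<noteq> 0 \<longrightarrow> size m \<le> d) \<and> (\<forall>\<pi> m. bij \<pi> \<longrightarrow> f (image_mset \<pi> m) = f m)"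
    and g: "(\<exists>d. \<forall>m. g m \<noteq> 0 \<longrightarrow> size m \<le> d) \<and> (\<forall>\<pi> m. bij \<pi> \<longrightarrow> g (image_mset \<pi> m) = g m)"
  obtain d e where "\<forall>m. f m \<noteq> 0 \<longrightarrow> size m \<le> d" "\<forall>m. g m \<noteq> 0 \<longrightarrow> size m \<le> e"
    using f g by auto
  then show "\<exists>d. \<forall>m. conv_mset f g m \<noteq> 0 \<longrightarrow> size m \<le> d"
    using conv_mset_bounded by blast
  show "\<forall>\<pi> m. bij \<pi> \<longrightarrow> conv_mset f g (image_mset \<pi> m) = conv_mset f g m"
    using f g conv_mset_symmetric by blast
qed

instance
proof
  fix a b c :: sym_fun
  show "a + b + c = a + (b + c)" by transfer (simp add: add.assoc)
  show "a + b = b + a" by transfer (simp add: add.commute)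
  show "0 + a = a" by transfer simp
  show "- a + a = 0" by transfer simp
  show "a - b = a + - b" by (rule minus_sym_fun_def)
  show "a * b * c = a * (b * c)" by transfer (rule conv_mset_assoc)
  show "a * b = b * a" by transfer (rule conv_mset_commute)
  show "1 * a = a" by transfer (rule conv_mset_one)
  show "(a + b) * c = a * c + b * c" by transfer (rule conv_mset_distrib)
  show "(0::sym_fun) \<noteq> 1" by transfer (metis zero_neq_one)
qed

end

lift_definition sf_scale :: "rat \<Rightarrow> sym_fun \<Rightarrow> sym_fun" is "\<lambda>c f m. c * f m" by auto

text \<open>The power sum \<open>p\<^sub>k = \<Sum>\<^sub>i x\<^sub>i\<^sup>k\<close>, only ever used for \<open>k \<ge> 1\<close> (the formula below gives \<open>1\<close> for \<open>k = 0\<close>).\<close>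

lift_definition power_sum :: "nat \<Rightarrow> sym_fun" is
  "\<lambda>k m. if \<exists>i. m = replicate_mset k i then 1 else 0"
proof (intro CollectI conjI allI impI)
  fix k :: nat
  show "\<exists>d. \<forall>m :: nat multiset. (if \<exists>i. m = replicate_mset k i then 1 else (0::rat)) \<noteq> 0 \<longrightarrow> size m \<le> d"
    by (rule exI[of _ k]) auto
next
  fix k :: nat and \<pi> :: "nat \<Rightarrow> nat" and m
  assume "bij \<pi>"
  have "(\<exists>i. image_mset \<pi> m = replicate_mset k i) \<longleftrightarrow> (\<exists>i. m = replicate_mset k i)"
  proof
    assume "\<exists>i. image_mset \<pi> m = replicate_mset k i"
    then obtain i where "image_mset \<pi> m = replicate_mset k i" ..
    also have "\<dots> = image_mset \<pi> (replicate_mset k (inv \<pi> i))"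
      using \<open>bij \<pi>\<close> by (simp add: bij_is_surj surj_f_inv_f)
    finally have "m = replicate_mset k (inv \<pi> i)"
      using \<open>bij \<pi>\<close> by (metis bij_is_inj multiset.inj_map injD)
    then show "\<exists>i. m = replicate_mset k i" ..
  qed auto
  then show "(if \<exists>i. image_mset \<pi> m = replicate_mset k i then 1 else (0::rat)) =
      (if \<exists>i. m = replicate_mset k i then 1 else 0)" by simp
qed

definition power_sum_mset :: "nat multiset \<Rightarrow> sym_fun" where
  "power_sum_mset \<mu> = (\<Prod>k\<in>#\<mu>. power_sum k)"

section \<open>The Frobenius characteristic of a permutation representation\<close>

text \<open>The symmetric group on \<open>n\<close> letters consists of the permutations of \<^term>\<open>{..<n}\<close>.
  Fixed points contribute cycles of length 1 to the cycle type.\<close>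

definition cycle_type :: "nat \<Rightarrow> (nat \<Rightarrow> nat) \<Rightarrow> nat multiset" where
  "cycle_type n w = image_mset card (mset_set (orbit w ` {..<n}))"

definition frobenius_char :: "nat \<Rightarrow> ((nat \<Rightarrow> nat) \<Rightarrow> rat) \<Rightarrow> sym_fun" where
  "frobenius_char n \<chi> =
     sf_scale (1 / fact n)
       (\<Sum>w | w permutes {..<n}. sf_scale (\<chi> w) (power_sum_mset (cycle_type n w)))"

text \<open>The \<open>(y, x)\<close> entry of the matrix by which \<open>w\<close> acts on the vector space with basis a set \<open>X\<close>
  carrying the action \<open>act\<close>, and the trace of this matrix.\<close>

definition perm_rep_matrix :: "('g \<Rightarrow> 'a \<Rightarrow> 'a) \<Rightarrow> 'g \<Rightarrow> 'a \<Rightarrow> 'a \<Rightarrow> rat" where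
  "perm_rep_matrix act w y x = (if act w x = y then 1 else 0)"

definition perm_character :: "('g \<Rightarrow> 'a \<Rightarrow> 'a) \<Rightarrow> 'a set \<Rightarrow> 'g \<Rightarrow> rat" where
  "perm_character act X w = (\<Sum>x\<in>X. perm_rep_matrix act w x x)"

section \<open>Parking functions\<close>

text \<open>List positions start at 0, so the bound \<open>k + (i - 1) r\<close> on \<open>b\<^sub>i\<close> becomes \<open>k + i r\<close>.\<close>

definition parking_functions :: "nat \<Rightarrow> nat \<Rightarrow> nat \<Rightarrow> nat list set" where
  "parking_functions r k n =
     {a. length a = n \<and> (\<forall>x\<in>set a. x \<ge> 1) \<and> (\<forall>i<n. sort a ! i \<le> k + i * r)}"

text \<open>The left action \<open>(w \<cdot> a)\<^sub>i = a\<^bsub>w\<^sup>-\<^sup>1(i)\<^esub>\<close>.\<close>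

definition permute_coords :: "(nat \<Rightarrow> nat) \<Rightarrow> 'a list \<Rightarrow> 'a list" where
  "permute_coords w a = permute_list (inv w) a"

definition parking_frob :: "nat \<Rightarrow> nat \<Rightarrow> nat \<Rightarrow> sym_fun" where
  "parking_frob r k n =
     frobenius_char n (perm_character permute_coords (parking_functions r k n))"

definition parking_series :: "nat \<Rightarrow> nat \<Rightarrow> sym_fun fps" where
  "parking_series r k = Abs_fps (\<lambda>n. parking_frob r k n)"

lemma finite_parking_functions: "finite (parking_functions r k n)"
proof (rule finite_subset)
  show "parking_functions r k n \<subseteq> {a. set a \<subseteq> {..k + n * r} \<and> length a = n}"
  proof (clarsimp simp: parking_functions_def)
    fix a x assume *: "\<forall>i<length a. sort a ! i \<le> k + i * r" "x \<in> set a"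
    then obtain i where "i < length a" "sort a ! i = x"
      by (metis in_set_conv_nth length_sort set_sort)
    moreover from this(1) have "k + i * r \<le> k + length a * r" by simp
    ultimately show "x \<le> k + length a * r" using *(1) le_trans by blast
  qed
qed (auto intro: finite_lists_length_eq)

lemma permute_coords_parking_functions:
  assumes "w permutes {..<n}" "a \<in> parking_functions r k n"
  shows "permute_coords w a \<in> parking_functions r k n"
proof -
  have "inv w permutes {..<length a}"
    using assms by (auto simp: parking_functions_def permutes_inv)
  then have m: "mset (permute_coords w a) = mset a"
    unfolding permute_coords_def by (rule mset_permute_list)
  then have "sort (permute_coords w a) = sort a"
    by (metis properties_for_sort mset_sort sorted_sort)
  with m show ?thesis
    using assms(2) by (auto simp: parking_functions_def dest: mset_eq_length mset_eq_setD)
qed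

lemma permute_coords_compose:
  assumes "v permutes {..<length a}" "w permutes {..<length a}"
  shows "permute_coords (v \<circ> w) a = permute_coords v (permute_coords w a)"
  using assms unfolding permute_coords_def
  by (simp add: permutes_inv permute_list_compose permutes_inv_o o_inv_distrib permutes_bij)

lemma parking_frob_0: "parking_frob r k 0 = 1"
proof -
  have "sf_scale 1 f = f" for f by transfer simp
  moreover have "parking_functions r k 0 = {[]}" by (auto simp: parking_functions_def)
  ultimately show ?thesis
    by (simp add: parking_frob_def frobenius_char_def perm_character_def perm_rep_matrix_def
        permute_coords_def cycle_type_def power_sum_mset_def)
qed

end

theory Submission
  imports Defs
begin

text \<open>
  The coefficient of a monomial in a power sum product \<open>p\<^bsub>\<mu>(w)\<^esub>\<close> counts the colourings of the letters
  that are constant on the cycles of \<open>w\<close>. By Burnside's lemma the coefficient of \<open>x\<^sup>m\<close> in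
  \<open>F\<^sub>n\<^bsup>(r,k)\<^esup>\<close> is therefore the number of multisets of \<open>n\<close> pairs (value, colour) whose values
  form an \<open>(r,k)\<close>-parking function and whose colours form \<open>m\<close>. In such a multiset for \<open>k + l\<close>, let
  \<open>v\<close> be the least number with \<open>v = k + r \<cdot> #{values \<le> v}\<close>. The pairs with value at
  most \<open>v\<close> form a multiset for \<open>k\<close>, the others, shifted down by \<open>v\<close>, form one for \<open>l\<close>, and
  this is a bijection. So the series for \<open>k + l\<close> is the product of those for \<open>k\<close> and \<open>l\<close>.
\<close>

section \<open>Symmetric functions as weight enumerators\<close>

text \<open>\<open>X\<close> may be infinite, since colours range over all naturals. Only the weight
  classes must be finite, because \<open>card\<close> would report an infinite class as 0.\<close>

definition enumerates :: "sym_fun \<Rightarrow> 'a set \<Rightarrow> ('a \<Rightarrow> nat multiset) \<Rightarrow> bool" where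
  "enumerates F X wt \<longleftrightarrow>
     (\<forall>m. finite {x \<in> X. wt x = m} \<and> sf_coeff F m = of_nat (card {x \<in> X. wt x = m}))"

lemma enumerates_unique: "enumerates F X wt \<Longrightarrow> enumerates G X wt \<Longrightarrow> F = G"
  unfolding enumerates_def by (metis ext sf_coeff_inject)

lemma enumerates_bij_betw:
  assumes "enumerates F X wt" "bij_betw f X Y" "\<And>x. x \<in> X \<Longrightarrow> wt' (f x) = wt x"
  shows "enumerates F Y wt'"
proof -
  have bij: "bij_betw f {x \<in> X. wt x = m} {y \<in> Y. wt' y = m}" for m
    using assms(2,3) unfolding bij_betw_def by (auto simp: inj_on_def)
  show ?thesis
    using assms(1) bij_betw_finite[OF bij] bij_betw_same_card[OF bij] unfolding enumerates_def by simp
qed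

lemma sf_coeff_sum: "sf_coeff (\<Sum>i\<in>I. F i) m = (\<Sum>i\<in>I. sf_coeff (F i) m)"
  by (induction I rule: infinite_finite_induct) (simp_all add: zero_sym_fun.rep_eq plus_sym_fun.rep_eq)

lemma enumerates_sum:
  assumes "finite I" "\<And>i. i \<in> I \<Longrightarrow> enumerates (F i) (X i) (wt i)"
  shows "enumerates (\<Sum>i\<in>I. F i) (Sigma I X) (\<lambda>(i, x). wt i x)"
  unfolding enumerates_def
proof
  fix m
  have eq: "{p \<in> Sigma I X. (case p of (i, x) \<Rightarrow> wt i x) = m} = (SIGMA i:I. {x \<in> X i. wt i x = m})"
    by auto
  show "finite {p \<in> Sigma I X. (case p of (i, x) \<Rightarrow> wt i x) = m} \<and>
      sf_coeff (\<Sum>i\<in>I. F i) m = of_nat (card {p \<in> Sigma I X. (case p of (i, x) \<Rightarrow> wt i x) = m})"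
    unfolding eq using assms by (auto simp: sf_coeff_sum enumerates_def intro!: finite_SigmaI)
qed

text \<open>Serves for character values: a number of fixed points becomes a weightless extra factor
  \<open>A\<close>.\<close>

lemma enumerates_scale:
  assumes "finite A" "enumerates F X wt"
  shows "enumerates (sf_scale (of_nat (card A)) F) (A \<times> X) (\<lambda>(a, x). wt x)"
  unfolding enumerates_def
proof
  fix m
  have eq: "{p \<in> A \<times> X. (case p of (a, x) \<Rightarrow> wt x) = m} = A \<times> {x \<in> X. wt x = m}"
    by auto
  show "finite {p \<in> A \<times> X. (case p of (a, x) \<Rightarrow> wt x) = m} \<and>
      sf_coeff (sf_scale (of_nat (card A)) F) m =
        of_nat (card {p \<in> A \<times> X. (case p of (a, x) \<Rightarrow> wt x) = m})"
    unfolding eq using assms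
    by (auto simp: sf_scale.rep_eq enumerates_def card_cartesian_product)
qed

text \<open>Absorbs the factor \<open>1 / fact n\<close> of the Frobenius characteristic. As
  \<open>N > 0\<close>, every element of \<open>Y\<close> is hit, so finiteness of the weight
  classes passes from \<open>X\<close> to \<open>Y\<close>.\<close>

lemma enumerates_quotient:
  assumes "enumerates F X wt" "f ` X \<subseteq> Y" "\<And>x. x \<in> X \<Longrightarrow> wt' (f x) = wt x" "N > 0"
    "\<And>y. y \<in> Y \<Longrightarrow> card {x \<in> X. f x = y} = N"
  shows "enumerates (sf_scale (1 / of_nat N) F) Y wt'"
  unfolding enumerates_def
proof
  fix m
  let ?X = "{x \<in> X. wt x = m}" and ?Y = "{y \<in> Y. wt' y = m}"
  have finX: "finite ?X" and F: "sf_coeff F m = of_nat (card ?X)"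
    using assms(1) by (auto simp: enumerates_def)
  \<comment> \<open>Since \<open>f\<close> keeps weights, a fibre lies in a single weight class, so
    restricting to weight \<open>m\<close> does not shrink it.\<close>
  have fib: "{x \<in> ?X. f x = y} = {x \<in> X. f x = y}" if "y \<in> ?Y" for y
    using that assms(3) by auto
  have "?Y \<subseteq> f ` ?X"
  proof
    fix y assume y: "y \<in> ?Y"
    then have "{x \<in> ?X. f x = y} \<noteq> {}"
      using assms(4,5) fib[OF y] by (metis (no_types, lifting) card.empty less_numeral_extra(3) mem_Collect_eq)
    then show "y \<in> f ` ?X" by auto
  qed
  then have finY: "finite ?Y" using finX finite_surj by blast
  have "f ` ?X \<subseteq> ?Y" using assms(2,3) by auto
  then have "card ?X = (\<Sum>y\<in>?Y. card {x \<in> ?X. f x = y})"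
    using sum.group[OF finX finY, of f "\<lambda>_. 1::nat"] by simp
  also have "\<dots> = (\<Sum>y\<in>?Y. N)"
    using assms(5) by (intro sum.cong) (simp_all only: fib, auto)
  finally show "finite ?Y \<and> sf_coeff (sf_scale (1 / of_nat N) F) m = of_nat (card ?Y)"
    using finY F assms(4) by (simp add: sf_scale.rep_eq)
qed

text \<open>The convolution runs over the splittings \<open>m = a + b\<close>, and a pair of total
  weight \<open>m\<close> lies over exactly one of them.\<close>

lemma enumerates_times:
  assumes "enumerates F X wt" "enumerates G Y wt'"
  shows "enumerates (F * G) (X \<times> Y) (\<lambda>(x, y). wt x + wt' y)"
  unfolding enumerates_def
proof
  fix m
  let ?D = "{(a, b). a + b = (m :: nat multiset)}"
  let ?S = "SIGMA p:?D. {x \<in> X. wt x = fst p} \<times> {y \<in> Y. wt' y = snd p}"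
  let ?Z = "{z \<in> X \<times> Y. (case z of (x, y) \<Rightarrow> wt x + wt' y) = m}"
  have bij: "bij_betw snd ?S ?Z"
    by (rule bij_betw_byWitness[where f' = "\<lambda>(x, y). ((wt x, wt' y), (x, y))"]) auto
  have fin: "finite {x \<in> X. wt x = a}" "finite {y \<in> Y. wt' y = a}" for a
    using assms by (auto simp: enumerates_def)
  have "sf_coeff (F * G) m =
      (\<Sum>p\<in>?D. of_nat (card ({x \<in> X. wt x = fst p} \<times> {y \<in> Y. wt' y = snd p})))"
    using assms unfolding times_sym_fun.rep_eq conv_mset_def enumerates_def
    by (intro sum.cong) (auto simp: card_cartesian_product)
  also have "\<dots> = of_nat (card ?S)"
    using fin finite_mset_splits[of m] by (subst card_SigmaI) (simp_all add: finite_cartesian_product)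
  finally show "finite ?Z \<and> sf_coeff (F * G) m = of_nat (card ?Z)"
    using bij_betw_same_card[OF bij] bij_betw_finite[OF bij] fin finite_mset_splits[of m]
    by (simp add: finite_SigmaI finite_cartesian_product)
qed

lemma enumerates_prod:
  assumes "finite S" "\<And>s. s \<in> S \<Longrightarrow> enumerates (F s) (X s) (wt s)"
  shows "enumerates (\<Prod>s\<in>S. F s) (PiE S X) (\<lambda>c. \<Sum>s\<in>S. wt s (c s))"
  using assms
proof (induction S rule: finite_induct)
  case empty
  have "finite {m. m = {#}}" by simp
  then show ?case by (auto simp: enumerates_def one_sym_fun.rep_eq)
next
  case (insert s S)
  have "enumerates (F s * (\<Prod>s\<in>S. F s)) (X s \<times> PiE S X) (\<lambda>(y, c). wt s y + (\<Sum>s\<in>S. wt s (c s)))"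
    using insert by (intro enumerates_times) auto
  moreover have "bij_betw (\<lambda>(y, c). c(s := y)) (X s \<times> PiE S X) (PiE (insert s S) X)"
    using insert.hyps(2) by (auto simp: bij_betw_def PiE_insert_eq intro: inj_combinator)
  moreover have "(\<Sum>t\<in>S. wt t (if t = s then y else c t)) = (\<Sum>t\<in>S. wt t (c t))" for y c
    using insert.hyps(2) by (intro sum.cong) auto
  ultimately show ?case
    using insert.hyps by (auto intro!: enumerates_bij_betw[where f = "\<lambda>(y, c). c(s := y)"])
qed

text \<open>A positive exponent lets the colour be read off its weight; for \<open>k = 0\<close> all
  colours would share the weight \<open>{#}\<close>.\<close>

lemma enumerates_power_sum:
  assumes "k > 0"
  shows "enumerates (power_sum k) UNIV (replicate_mset k)"
  unfolding enumerates_def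
proof
  fix m
  show "finite {i \<in> UNIV. replicate_mset k i = m} \<and>
      sf_coeff (power_sum k) m = of_nat (card {i \<in> UNIV. replicate_mset k i = m})"
  proof (cases "\<exists>i. m = replicate_mset k i")
    case True
    then obtain i where "m = replicate_mset k i" ..
    then have "{i \<in> UNIV. replicate_mset k i = m} = {i}"
      using assms by (auto simp: replicate_mset_eq_iff)
    then show ?thesis using True by (simp add: power_sum.rep_eq)
  next
    case False
    then have "{i \<in> UNIV. replicate_mset k i = m} = {}" by auto
    then show ?thesis using False by (simp only: power_sum.rep_eq) simp
  qed
qed

section \<open>Colourings fixed by a permutation\<close>

text \<open>The action uses \<open>inv w\<close>, but invariance under \<open>inv w\<close> and
  under \<open>w\<close> agree. The form with \<open>w\<close> follows the direction in which
  \<open>orbit w\<close> is generated.\<close>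

lemma permute_coords_fixed_iff:
  assumes "w permutes {..<length c}"
  shows "permute_coords w c = c \<longleftrightarrow> (\<forall>i<length c. c ! w i = c ! i)"
proof -
  have w: "inv w permutes {..<length c}" using assms by (rule permutes_inv)
  have lt: "w i < length c \<longleftrightarrow> i < length c" "inv w i < length c \<longleftrightarrow> i < length c" for i
    using permutes_in_image[OF assms, of i] permutes_in_image[OF w, of i] by auto
  have "permute_coords w c = c \<longleftrightarrow> (\<forall>i<length c. c ! inv w i = c ! i)"
    unfolding permute_coords_def using w by (auto simp: list_eq_iff_nth_eq permute_list_nth)
  also have "\<dots> \<longleftrightarrow> (\<forall>i<length c. c ! w i = c ! i)"
    using lt permutes_inverses[OF assms] by metis
  finally show ?thesis .
qed

text \<open>Expanding the product picks one colour per cycle, and a cycle \<open>s\<close>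
  contributes its colour \<open>card s\<close> times, once per letter. Spreading the colours over
  the letters gives exactly the lists fixed by \<open>w\<close>.\<close>

lemma enumerates_power_sum_cycle_type:
  assumes w: "w permutes {..<n}"
  shows "enumerates (power_sum_mset (cycle_type n w))
           {c. length c = n \<and> permute_coords w c = c} mset"
proof -
  let ?O = "orbit w ` {..<n}"
  have perm: "permutation w" using w by (auto simp: permutation_permutes)
  have self: "x \<in> orbit w x" for x using perm by (rule permutation_self_in_orbit)
  have orb_eq: "orbit w y = orbit w x" if "y \<in> orbit w x" for x y
    using cyclic_on_orbit'[OF perm] that by (rule orbit_cyclic_eq3)
  have sub: "orbit w x \<subseteq> {..<n}" if "x < n" for x
    using permutes_orbit_subset[OF w] that by auto
  have fin: "finite (orbit w x)" if "x < n" for x using finite_subset[OF sub[OF that]] by simp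
  have "power_sum_mset (cycle_type n w) = (\<Prod>s\<in>?O. power_sum (card s))"
    by (simp add: power_sum_mset_def cycle_type_def image_mset.compositionality o_def prod_unfold_prod_mset)
  moreover have "enumerates (\<Prod>s\<in>?O. power_sum (card s)) (?O \<rightarrow>\<^sub>E UNIV)
      (\<lambda>c. \<Sum>s\<in>?O. replicate_mset (card s) (c s))"
  proof (rule enumerates_prod)
    fix s assume "s \<in> ?O"
    then have "card s > 0" using fin self by (auto simp: card_gt_0_iff)
    then show "enumerates (power_sum (card s)) UNIV (replicate_mset (card s))"
      by (rule enumerates_power_sum)
  qed simp
  ultimately have 1: "enumerates (power_sum_mset (cycle_type n w)) (?O \<rightarrow>\<^sub>E UNIV)
      (\<lambda>c. \<Sum>s\<in>?O. replicate_mset (card s) (c s))" by simp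
  let ?f = "\<lambda>c :: nat set \<Rightarrow> nat. map (\<lambda>i. c (orbit w i)) [0..<n]"
  \<comment> \<open>The colour of an orbit is read at an arbitrary letter of it; by
    \<open>const\<close> below the choice does not matter for fixed lists.\<close>
  let ?g = "\<lambda>l :: nat list. \<lambda>s\<in>?O. l ! (SOME i. i \<in> s)"
  have some: "(SOME i. i \<in> orbit w x) \<in> orbit w x" for x using self by (rule someI)
  have const: "c ! y = c ! x"
    if "length c = n" "permute_coords w c = c" "x < n" "y \<in> orbit w x" for c :: "nat list" and x y
    using that(4)
  proof (induction rule: orbit.induct)
    case base
    then show ?case using that permute_coords_fixed_iff[of w c] w by simp
  next
    case (step y)
    then show ?case using that permute_coords_fixed_iff[of w c] w sub[OF that(3)] by auto
  qed
  have 2: "bij_betw ?f (?O \<rightarrow>\<^sub>E UNIV) {c. length c = n \<and> permute_coords w c = c}"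
  proof (rule bij_betw_byWitness[where f' = ?g])
    show "\<forall>c\<in>?O \<rightarrow>\<^sub>E UNIV. ?g (?f c) = c"
    proof
      fix c :: "nat set \<Rightarrow> nat" assume c: "c \<in> ?O \<rightarrow>\<^sub>E UNIV"
      show "?g (?f c) = c"
      proof (rule ext)
        fix s
        show "?g (?f c) s = c s"
        proof (cases "s \<in> ?O")
          case True
          then obtain x where x: "x < n" "s = orbit w x" by auto
          let ?i = "SOME i. i \<in> s"
          have "?i \<in> s" unfolding x(2) by (rule some)
          then have "?i < n" "orbit w ?i = s" using x sub[OF x(1)] orb_eq[of ?i x] by auto
          then show ?thesis using True by simp
        next
          case False
          then show ?thesis using PiE_arb[OF c False] by (simp only: restrict_apply if_False)
        qed
      qed
    qed
    show "\<forall>l\<in>{c. length c = n \<and> permute_coords w c = c}. ?f (?g l) = l"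
    proof (rule ballI, rule nth_equalityI)
      fix l :: "nat list" and i
      assume "l \<in> {c. length c = n \<and> permute_coords w c = c}" and "i < length (?f (?g l))"
      then have l: "length l = n" "permute_coords w l = l" and i: "i < n" by auto
      have "?f (?g l) ! i = l ! (SOME j. j \<in> orbit w i)" using i by simp
      also have "\<dots> = l ! i" using l i some by (rule const)
      finally show "?f (?g l) ! i = l ! i" .
    qed auto
    show "?f ` (?O \<rightarrow>\<^sub>E UNIV) \<subseteq> {c. length c = n \<and> permute_coords w c = c}"
    proof (clarify, intro conjI)
      fix c :: "nat set \<Rightarrow> nat"
      have "orbit w (w i) = orbit w i" for i by (rule orb_eq) (rule orbit.base)
      moreover have "w i < n" if "i < n" for i using permutes_in_image[OF w, of i] that by simp
      ultimately show "permute_coords w (?f c) = ?f c"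
        using w by (subst permute_coords_fixed_iff) auto
    qed simp
    show "?g ` {c. length c = n \<and> permute_coords w c = c} \<subseteq> ?O \<rightarrow>\<^sub>E UNIV" by auto
  qed
  have 3: "mset (?f c) = (\<Sum>s\<in>?O. replicate_mset (card s) (c s))" for c :: "nat set \<Rightarrow> nat"
  proof -
    have "mset (?f c) = image_mset (\<lambda>i. c (orbit w i)) (mset_set {..<n})"
      by (simp add: atLeast0LessThan)
    also have "\<dots> = (\<Sum>i\<in>{..<n}. {#c (orbit w i)#})"
      by (simp only: sum_unfold_sum_mset sum_mset_singleton_mset)
    \<comment> \<open>Letters are grouped by their orbit. The group belonging to an orbit
      \<open>s\<close> is \<open>s\<close> itself, which accounts for the multiplicity
      \<open>card s\<close>.\<close>
    also have "\<dots> = (\<Sum>s\<in>?O. \<Sum>i\<in>{i\<in>{..<n}. orbit w i = s}. {#c (orbit w i)#})"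
      by (rule sum.group[symmetric]) auto
    also have "\<dots> = (\<Sum>s\<in>?O. replicate_mset (card s) (c s))"
    proof (rule sum.cong)
      fix s assume "s \<in> ?O"
      then obtain x where x: "x < n" "s = orbit w x" by auto
      then have s: "{i\<in>{..<n}. orbit w i = s} = s" using sub[OF x(1)] self orb_eq by blast
      have "(\<Sum>i\<in>{i\<in>{..<n}. orbit w i = s}. {#c (orbit w i)#}) =
          (\<Sum>i\<in>{i\<in>{..<n}. orbit w i = s}. {#c s#})" by (rule sum.cong) auto
      also have "\<dots> = (\<Sum>i\<in>s. {#c s#})" by (simp only: s)
      also have "\<dots> = replicate_mset (card s) (c s)"
        by (simp add: multiset_eq_iff count_sum)
      finally show "(\<Sum>i\<in>{i\<in>{..<n}. orbit w i = s}. {#c (orbit w i)#}) = replicate_mset (card s) (c s)" .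
    qed simp
    finally show ?thesis .
  qed
  show ?thesis using 1 2 3 by (rule enumerates_bij_betw)
qed

section \<open>Burnside counting for parking functions\<close>

text \<open>Orbit-stabiliser argument: for a fixed arrangement \<open>z0\<close> of
  \<open>M\<close>, as many permutations carry \<open>z0\<close> to \<open>z\<close> as fix
  \<open>z\<close>. Every permutation carries \<open>z0\<close> to exactly one \<open>z\<close>, so
  the sum over \<open>z\<close> counts the whole group.\<close>

lemma card_fixed_rearrangements:
  assumes "size M = n"
  shows "card (SIGMA z:{z. mset z = M}. {w. w permutes {..<n} \<and> permute_coords w z = z}) = fact n"
proof -
  let ?P = "{w. w permutes {..<n}}" and ?Z = "{z. mset z = M}"
  obtain z0 where z0: "mset z0 = M" using ex_mset by metis
  have len: "length z = n" if "z \<in> ?Z" for z using that assms by auto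
  have len0: "length z0 = n" using z0 len by simp
  have finP: "finite ?P" by (simp add: finite_permutations)
  have img: "permute_coords w z0 \<in> ?Z" if "w \<in> ?P" for w
    using that z0 len0 by (simp add: permute_coords_def permutes_inv)
  have card_fib: "card {w \<in> ?P. permute_coords w z0 = z} = card {w \<in> ?P. permute_coords w z = z}"
    if z: "z \<in> ?Z" for z
  proof -
    \<comment> \<open>\<open>permute_list u\<close> acts without the inverse, so the group element
      carrying \<open>z0\<close> to \<open>z\<close> is \<open>inv u\<close>.\<close>
    obtain u where "u permutes {..<length z0}" "permute_list u z0 = z"
      using z z0 mset_eq_permutation[of z z0] by auto
    then have v: "inv u permutes {..<n}" and vz: "permute_coords (inv u) z0 = z"
      using len0 by (auto simp: permute_coords_def permutes_inv permutes_inv_inv)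
    have vz': "permute_coords u z = z0"
      using permute_coords_compose[of u z0 "inv u"] vz v len0 \<open>u permutes {..<length z0}\<close>
      by (simp add: permutes_inv_o permute_coords_def)
    \<comment> \<open>The permutations carrying \<open>z0\<close> to \<open>z\<close> form a coset
      of the stabiliser of \<open>z\<close>, obtained by composing on the right with
      \<open>inv u\<close>.\<close>
    have "bij_betw (\<lambda>w. w \<circ> inv u) {w \<in> ?P. permute_coords w z = z} {w \<in> ?P. permute_coords w z0 = z}"
    proof (rule bij_betw_byWitness[where f' = "\<lambda>w. w \<circ> u"])
      show "\<forall>w\<in>{w \<in> ?P. permute_coords w z = z}. (w \<circ> inv u) \<circ> u = w"
        using \<open>u permutes _\<close> by (auto simp: comp_assoc permutes_inv_o)
      show "\<forall>w\<in>{w \<in> ?P. permute_coords w z0 = z}. (w \<circ> u) \<circ> inv u = w"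
        using \<open>u permutes _\<close> by (auto simp: comp_assoc permutes_inv_o)
      show "(\<lambda>w. w \<circ> inv u) ` {w \<in> ?P. permute_coords w z = z} \<subseteq> {w \<in> ?P. permute_coords w z0 = z}"
        using v vz len0 by (auto simp: permute_coords_compose permutes_compose)
      show "(\<lambda>w. w \<circ> u) ` {w \<in> ?P. permute_coords w z0 = z} \<subseteq> {w \<in> ?P. permute_coords w z = z}"
        using \<open>u permutes _\<close> vz' len0 len[OF z] by (auto simp: permute_coords_compose permutes_compose)
    qed
    then show ?thesis by (simp add: bij_betw_same_card)
  qed
  have finZ: "finite ?Z"
    by (rule finite_subset[of _ "{z. set z \<subseteq> set_mset M \<and> length z = n}"])
      (use len in \<open>auto intro: finite_lists_length_eq\<close>)
  have "card (SIGMA z:?Z. {w \<in> ?P. permute_coords w z = z}) =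
      (\<Sum>z\<in>?Z. card {w \<in> ?P. permute_coords w z = z})"
    using finZ finP by simp
  also have "\<dots> = (\<Sum>z\<in>?Z. card {w \<in> ?P. permute_coords w z0 = z})"
    using card_fib by simp
  also have "\<dots> = card ?P"
    using sum.group[OF finP finZ, of "\<lambda>w. permute_coords w z0" "\<lambda>_. 1::nat"] img by auto
  also have "\<dots> = fact n" by (simp add: card_permutations)
  finally show ?thesis by simp
qed

section \<open>Parking functions as multisets of coloured values\<close>

definition count_le :: "nat \<Rightarrow> (nat \<times> nat) multiset \<Rightarrow> nat" where
  "count_le v M = size (filter_mset (\<lambda>p. fst p \<le> v) M)"

text \<open>The parking condition without sorting: if only \<open>N < n\<close> values are at most
  \<open>v\<close>, the next value in sorted order exceeds \<open>v\<close> and must be at most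
  \<open>k + r * N\<close>. Colours are unconstrained.\<close>

definition coloured_parking :: "nat \<Rightarrow> nat \<Rightarrow> nat \<Rightarrow> (nat \<times> nat) multiset set" where
  "coloured_parking r k n =
     {M. size M = n \<and> (\<forall>p\<in>#M. fst p \<ge> 1) \<and> (\<forall>v. count_le v M < n \<longrightarrow> v < k + r * count_le v M)}"

text \<open>In a sorted list the entries at most \<open>v\<close> form an initial segment.\<close>

lemma sorted_nth_le_iff:
  assumes "sorted xs" "i < length xs"
  shows "xs ! i \<le> v \<longleftrightarrow> i < length (filter (\<lambda>x. x \<le> v) xs)"
  using assms
proof (induction xs arbitrary: i)
  case (Cons x xs)
  show ?case
  proof (cases "x \<le> v")
    case True
    then show ?thesis using Cons by (cases i) auto
  next
    case False
    then have "filter (\<lambda>x. x \<le> v) xs = []" using Cons.prems by (auto simp: filter_empty_conv)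
    moreover have "x \<le> (x # xs) ! i"
      using Cons.prems sorted_nth_mono[of "x # xs" 0 i] by simp
    ultimately show ?thesis using False by auto
  qed
qed simp

lemma coloured_parking_mset_zip:
  assumes "length a = n" "length c = n"
  shows "mset (zip a c) \<in> coloured_parking r k n \<longleftrightarrow> a \<in> parking_functions r k n"
proof -
  let ?N = "\<lambda>v. length (filter (\<lambda>x. x \<le> v) (sort a))"
  have N: "count_le v (mset (zip a c)) = ?N v" for v
  proof -
    have "count_le v (mset (zip a c)) = size (filter_mset (\<lambda>x. x \<le> v) (mset (map fst (zip a c))))"
      by (simp add: count_le_def filter_mset_image_mset o_def)
    also have "\<dots> = size (filter_mset (\<lambda>x. x \<le> v) (mset (sort a)))"
      using assms by simp
    finally show ?thesis by (metis mset_filter size_mset)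
  qed
  have pos: "(\<forall>p\<in>#mset (zip a c). fst p \<ge> 1) \<longleftrightarrow> (\<forall>x\<in>set a. x \<ge> 1)"
  proof -
    have "set a = fst ` set (zip a c)" using assms by (simp flip: set_map)
    then show ?thesis by simp
  qed
  have nth: "sort a ! i \<le> v \<longleftrightarrow> i < ?N v" if "i < n" for i v
    using that assms by (intro sorted_nth_le_iff) auto
  \<comment> \<open>Forwards, the condition is used at \<open>v = k + i * r\<close>; backwards, the
    bound is used at the 0-based position \<open>i = ?N v\<close>, the first entry above
    \<open>v\<close>.\<close>
  have "(\<forall>v. ?N v < n \<longrightarrow> v < k + r * ?N v) \<longleftrightarrow> (\<forall>i<n. i < ?N (k + i * r))"
  proof
    assume L: "\<forall>v. ?N v < n \<longrightarrow> v < k + r * ?N v"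
    show "\<forall>i<n. i < ?N (k + i * r)"
    proof (intro allI impI, rule ccontr)
      fix i assume "i < n" and le: "\<not> i < ?N (k + i * r)"
      then have "?N (k + i * r) < n" by simp
      then have "k + i * r < k + r * ?N (k + i * r)" using L by blast
      then show False using le by (simp add: mult.commute)
    qed
  next
    assume R: "\<forall>i<n. i < ?N (k + i * r)"
    show "\<forall>v. ?N v < n \<longrightarrow> v < k + r * ?N v"
    proof (intro allI impI, rule ccontr)
      fix v assume lt: "?N v < n" and "\<not> v < k + r * ?N v"
      then have "k + ?N v * r \<le> v" by (simp add: mult.commute)
      moreover have "sort a ! ?N v \<le> k + ?N v * r" using R lt nth by blast
      ultimately have "sort a ! ?N v \<le> v" by simp
      then show False using nth[OF lt] by simp
    qed
  qed
  then show ?thesis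
    using assms pos nth by (simp add: coloured_parking_def parking_functions_def N)
qed

text \<open>Burnside: the sum over the group enumerates triples of a permutation, a parking function
  and a colouring, both fixed by it. Forgetting the permutation and the order of the positions is a
  map onto coloured multisets whose fibres all have \<open>fact n\<close> elements.\<close>

lemma enumerates_parking_frob:
  "enumerates (parking_frob r k n) (coloured_parking r k n) (image_mset snd)"
proof -
  let ?P = "{w. w permutes {..<n}}" and ?PF = "parking_functions r k n"
  let ?A = "\<lambda>w. {a \<in> ?PF. permute_coords w a = a}"
  let ?C = "\<lambda>w. {c :: nat list. length c = n \<and> permute_coords w c = c}"
  let ?X = "SIGMA w:?P. ?A w \<times> ?C w"
  let ?chi = "perm_character permute_coords ?PF"
  \<comment> \<open>The trace of a permutation matrix is its number of fixed points.\<close>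
  have chi: "?chi w = of_nat (card (?A w))" for w
    unfolding perm_character_def perm_rep_matrix_def
    by (simp add: sum.If_cases finite_parking_functions Int_def)
  have "enumerates (\<Sum>w\<in>?P. sf_scale (?chi w) (power_sum_mset (cycle_type n w))) ?X
      (\<lambda>(w, p). (case p of (a, c) \<Rightarrow> mset c))"
    unfolding chi using finite_parking_functions[of r k n]
    by (intro enumerates_sum enumerates_scale enumerates_power_sum_cycle_type)
       (auto simp: finite_permutations)
  then have E: "enumerates (\<Sum>w\<in>?P. sf_scale (?chi w) (power_sum_mset (cycle_type n w))) ?X
      (\<lambda>(w, a, c). mset c)" by (simp add: case_prod_beta')
  have "enumerates (sf_scale (1 / of_nat (fact n))
      (\<Sum>w\<in>?P. sf_scale (?chi w) (power_sum_mset (cycle_type n w))))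
      (coloured_parking r k n) (image_mset snd)"
  proof (rule enumerates_quotient[OF E, where f = "\<lambda>(w, a, c). mset (zip a c)"])
    show "(\<lambda>(w, a, c). mset (zip a c)) ` ?X \<subseteq> coloured_parking r k n"
      by (clarsimp) (metis (mono_tags, lifting) coloured_parking_mset_zip mem_Collect_eq parking_functions_def)
    show "image_mset snd (case x of (w, a, c) \<Rightarrow> mset (zip a c)) = (case x of (w, a, c) \<Rightarrow> mset c)"
      if "x \<in> ?X" for x
      using that by (auto simp: parking_functions_def simp flip: mset_map)
    show "(fact n :: nat) > 0" by simp
    fix M assume M: "M \<in> coloured_parking r k n"
    then have size: "size M = n" by (simp add: coloured_parking_def)
    let ?S = "SIGMA z:{z. mset z = M}. {w. w permutes {..<n} \<and> permute_coords w z = z}"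
    \<comment> \<open>This turns the triples over \<open>M\<close> into pairs of an arrangement of
      \<open>M\<close> and a permutation fixing it, as counted by
      \<open>card_fixed_rearrangements\<close>.\<close>
    have fixed_zip: "permute_coords w (zip a c) = zip a c \<longleftrightarrow> permute_coords w a = a \<and> permute_coords w c = c"
      if "w permutes {..<n}" "length a = n" "length c = n" for w and a c :: "nat list"
      using that permutes_in_image[OF that(1)] by (auto simp: permute_coords_fixed_iff)
    have "bij_betw (\<lambda>(z, w). (w, map fst z, map snd z)) ?S
        {x \<in> ?X. (case x of (w, a, c) \<Rightarrow> mset (zip a c)) = M}"
    proof (rule bij_betw_byWitness[where f' = "\<lambda>(w, a, c). (zip a c, w)"])
      show "(\<lambda>(z, w). (w, map fst z, map snd z)) ` ?S
          \<subseteq> {x \<in> ?X. (case x of (w, a, c) \<Rightarrow> mset (zip a c)) = M}"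
      proof
        fix x assume "x \<in> (\<lambda>(z, w). (w, map fst z, map snd z)) ` ?S"
        then obtain z w where x: "x = (w, map fst z, map snd z)" and z: "mset z = M"
          and w: "w permutes {..<n}" "permute_coords w z = z" by auto
        have len: "length (map fst z) = n" "length (map snd z) = n" using size z by auto
        have zip: "zip (map fst z) (map snd z) = z" by (rule zip_map_fst_snd)
        have "map fst z \<in> parking_functions r k n"
          using coloured_parking_mset_zip[OF len, of r k] M z by (simp only: zip)
        moreover have "permute_coords w (map fst z) = map fst z" "permute_coords w (map snd z) = map snd z"
          using fixed_zip[OF w(1) len] w(2) unfolding zip by blast+
        ultimately show "x \<in> {x \<in> ?X. (case x of (w, a, c) \<Rightarrow> mset (zip a c)) = M}"
          unfolding x using w(1) z len(2) zip by simp
      qed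
      show "(\<lambda>(w, a, c). (zip a c, w)) ` {x \<in> ?X. (case x of (w, a, c) \<Rightarrow> mset (zip a c)) = M} \<subseteq> ?S"
        using fixed_zip by (auto simp: parking_functions_def)
    qed (auto simp: zip_map_fst_snd parking_functions_def)
    then show "card {x \<in> ?X. (case x of (w, a, c) \<Rightarrow> mset (zip a c)) = M} = fact n"
      using card_fixed_rearrangements[OF size] by (metis (no_types, lifting) bij_betw_same_card)
  qed
  then show ?thesis by (simp add: parking_frob_def frobenius_char_def)
qed

section \<open>Splitting a parking function\<close>

abbreviation shift_values :: "nat \<Rightarrow> (nat \<times> nat) multiset \<Rightarrow> (nat \<times> nat) multiset" where
  "shift_values v \<equiv> image_mset (map_prod (\<lambda>x. x + v) id)"

lemma count_le_union: "count_le v (A + B) = count_le v A + count_le v B"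
  by (simp add: count_le_def)

lemma count_le_mono: "u \<le> v \<Longrightarrow> count_le u M \<le> count_le v M"
  unfolding count_le_def by (intro size_mset_mono filter_mset_mono_strong) auto

lemma count_le_size: "count_le v M \<le> size M"
  by (simp add: count_le_def size_filter_mset_lesseq)

lemma count_le_eq_size_iff: "count_le v M = size M \<longleftrightarrow> (\<forall>p\<in>#M. fst p \<le> v)"
proof
  show "count_le v M = size M \<Longrightarrow> \<forall>p\<in>#M. fst p \<le> v"
    unfolding count_le_def using size_filter_unsat_elem[of _ M "\<lambda>p. fst p \<le> v"] by fastforce
  show "\<forall>p\<in>#M. fst p \<le> v \<Longrightarrow> count_le v M = size M"
    unfolding count_le_def using filter_mset_cong0[of M "\<lambda>p. fst p \<le> v" "\<lambda>_. True"] by simp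
qed

lemma count_le_shift_values: "count_le (v + u) (shift_values v M) = count_le u M"
  by (simp add: count_le_def filter_mset_image_mset o_def add.commute)

lemma count_le_shift_values_0:
  assumes "\<forall>p\<in>#M. fst p \<ge> 1" "u \<le> v"
  shows "count_le u (shift_values v M) = 0"
  using assms by (fastforce simp: count_le_def)

lemma coloured_parking_count_le_iff:
  "M \<in> coloured_parking r k n \<Longrightarrow> count_le v M = n \<longleftrightarrow> (\<forall>p\<in>#M. fst p \<le> v)"
  using count_le_eq_size_iff by (auto simp: coloured_parking_def)

text \<open>If some value exceeded \<open>v = k + r * i\<close>, then
  \<open>count_le v A < i\<close>, and the parking condition at \<open>v\<close> would give
  \<open>v < v\<close>. Hence all of \<open>A\<close> stays below the shifted part when two
  multisets are joined at \<open>v\<close>.\<close>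

lemma coloured_parking_le:
  assumes "A \<in> coloured_parking r k i" "p \<in># A"
  shows "fst p \<le> k + r * i"
proof -
  have sz: "size A = i" using assms by (simp add: coloured_parking_def)
  have "count_le (k + r * i) A = i"
  proof (rule ccontr)
    assume ne: "count_le (k + r * i) A \<noteq> i"
    then have lt: "count_le (k + r * i) A < i" using count_le_size[of "k + r * i" A] sz by simp
    then have "k + r * i < k + r * count_le (k + r * i) A"
      using assms(1) unfolding coloured_parking_def by blast
    moreover have "r * count_le (k + r * i) A \<le> r * i" using lt by simp
    ultimately show False by linarith
  qed
  then show ?thesis using assms coloured_parking_count_le_iff by blast
qed

section \<open>The cut point\<close>

definition cut :: "nat \<Rightarrow> nat \<Rightarrow> (nat \<times> nat) multiset \<Rightarrow> nat" where
  "cut r k M = (LEAST v. k + r * count_le v M \<le> v)"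

lemma cut_le: "k + r * count_le (cut r k M) M \<le> cut r k M"
  unfolding cut_def by (rule LeastI[of _ "k + r * size M"]) (simp add: count_le_size)

lemma less_cut: "v < cut r k M \<Longrightarrow> v < k + r * count_le v M"
  unfolding cut_def using not_less_Least by fastforce

text \<open>The identity rises in steps of 1 and the right-hand side never falls, so at the first
  \<open>v\<close> where the identity catches up it cannot overshoot.\<close>

lemma cut_eq: "cut r k M = k + r * count_le (cut r k M) M"
proof (cases "cut r k M")
  case 0
  then show ?thesis using cut_le[of k r M] by simp
next
  case (Suc v)
  then have "v < k + r * count_le v M" by (intro less_cut) simp
  moreover have "r * count_le v M \<le> r * count_le (Suc v) M"
    by (intro mult_left_mono count_le_mono) auto
  ultimately show ?thesis using cut_le[of k r M] unfolding Suc by linarith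
qed

text \<open>Up to \<open>k + r * i\<close> only \<open>A\<close> is counted; beyond it all of
  \<open>A\<close> is, together with \<open>B\<close> shifted. The last three conclusions recover
  the two parts from \<open>M\<close> alone, which gives injectivity.\<close>

lemma coloured_parking_join:
  assumes A: "A \<in> coloured_parking r k i" and B: "B \<in> coloured_parking r l j"
  defines "M \<equiv> A + shift_values (k + r * i) B"
  shows "M \<in> coloured_parking r (k + l) (i + j)" "cut r k M = k + r * i"
    "filter_mset (\<lambda>p. fst p \<le> k + r * i) M = A"
    "filter_mset (\<lambda>p. \<not> fst p \<le> k + r * i) M = shift_values (k + r * i) B"
proof -
  let ?v = "k + r * i"
  have szA: "size A = i" and szB: "size B = j"
    and posA: "\<forall>p\<in>#A. fst p \<ge> 1" and posB: "\<forall>p\<in>#B. fst p \<ge> 1"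
    using A B by (auto simp: coloured_parking_def)
  have leA: "\<forall>p\<in>#A. fst p \<le> ?v" using coloured_parking_le[OF A] by blast
  have low: "count_le u M = count_le u A" if "u \<le> ?v" for u
    unfolding M_def using that count_le_shift_values_0[OF posB] by (simp add: count_le_union)
  have high: "count_le (?v + u) M = i + count_le u B" for u
  proof -
    have "count_le (?v + u) A = size A" using leA by (subst count_le_eq_size_iff) auto
    then show ?thesis unfolding M_def by (simp only: count_le_union count_le_shift_values szA)
  qed
  \<comment> \<open>Membership of \<open>A\<close> says nothing once all \<open>i\<close> pairs are
    counted; there the inequality is just \<open>u < ?v\<close>.\<close>
  have lowA: "u < k + r * count_le u A" if "u < ?v" for u
  proof (cases "count_le u A = i")
    case False
    then have "count_le u A < i" using count_le_size[of u A] szA by simp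
    then show ?thesis using A by (simp add: coloured_parking_def)
  qed (use that in simp)
  show "cut r k M = ?v"
    unfolding cut_def
  proof (rule Least_equality)
    have "count_le ?v M = i" using low[of ?v] coloured_parking_count_le_iff[OF A] leA by simp
    then show "k + r * count_le ?v M \<le> ?v" by simp
    show "?v \<le> u" if "k + r * count_le u M \<le> u" for u
      using that lowA[of u] low[of u] by (cases "u < ?v") auto
  qed
  \<comment> \<open>Below \<open>?v\<close> the condition for \<open>A\<close> suffices. For
    \<open>u = ?v + t\<close> the condition for \<open>B\<close> at \<open>t\<close>, raised by
    \<open>?v = k + r * i\<close>, is the one for \<open>M\<close>.\<close>
  have "u < k + l + r * count_le u M" if lt: "count_le u M < i + j" for u
  proof (cases "u < ?v")
    case True
    then show ?thesis using low[of u] lowA[of u] by simp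
  next
    case False
    then obtain t where t: "u = ?v + t" using le_Suc_ex not_less by blast
    then have "count_le t B < j" using lt high by simp
    then have "t < l + r * count_le t B" using B by (simp add: coloured_parking_def)
    then show ?thesis unfolding t high by (simp add: algebra_simps)
  qed
  moreover have "size M = i + j" by (simp add: M_def szA szB)
  moreover have "\<forall>p\<in>#M. fst p \<ge> 1" using posA posB by (auto simp: M_def)
  ultimately show "M \<in> coloured_parking r (k + l) (i + j)" by (simp add: coloured_parking_def)
  have shB: "\<not> fst p \<le> ?v" if "p \<in># shift_values ?v B" for p
    using that posB by fastforce
  have "filter_mset (\<lambda>p. fst p \<le> ?v) A = A" "filter_mset (\<lambda>p. \<not> fst p \<le> ?v) A = {#}"
    using leA by (auto simp: filter_mset_eq_conv)
  moreover have "filter_mset (\<lambda>p. fst p \<le> ?v) (shift_values ?v B) = {#}"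
    "filter_mset (\<lambda>p. \<not> fst p \<le> ?v) (shift_values ?v B) = shift_values ?v B"
    using shB by (simp_all add: filter_mset_eq_conv)
  ultimately show "filter_mset (\<lambda>p. fst p \<le> ?v) M = A"
    "filter_mset (\<lambda>p. \<not> fst p \<le> ?v) M = shift_values ?v B"
    by (simp_all only: M_def filter_union_mset add_0 add_0_right)
qed

lemma coloured_parking_split:
  assumes M: "M \<in> coloured_parking r (k + l) n"
  obtains i A B where "i \<le> n" "A \<in> coloured_parking r k i" "B \<in> coloured_parking r l (n - i)"
    "M = A + shift_values (k + r * i) B"
proof -
  define v where "v = cut r k M"
  define i where "i = count_le v M"
  define A where "A = filter_mset (\<lambda>p. fst p \<le> v) M"
  \<comment> \<open>The truncated subtraction is exact here, since only values above
    \<open>v\<close> remain, and it leaves values of at least 1.\<close>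
  define B where "B = image_mset (map_prod (\<lambda>x. x - v) id) (filter_mset (\<lambda>p. \<not> fst p \<le> v) M)"
  have v: "v = k + r * i" unfolding v_def i_def by (rule cut_eq)
  have sz: "size M = n" using M by (simp add: coloured_parking_def)
  have szA: "size A = i" by (simp add: A_def i_def count_le_def)
  have shB: "shift_values v B = filter_mset (\<lambda>p. \<not> fst p \<le> v) M"
  proof -
    have "shift_values v B = image_mset id (filter_mset (\<lambda>p. \<not> fst p \<le> v) M)"
      unfolding B_def image_mset.compositionality by (rule image_mset_cong) auto
    then show ?thesis by simp
  qed
  have join: "M = A + shift_values v B" unfolding A_def shB by simp
  have szB: "size B = n - i" using arg_cong[OF join, of size] szA sz by simp
  have i: "i \<le> n" using count_le_size[of v M] sz by (simp add: i_def)
  have posB: "\<forall>p\<in>#B. fst p \<ge> 1" by (auto simp: B_def)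
  have "A \<in> coloured_parking r k i"
  proof -
    have "u < k + r * count_le u A" if lt: "count_le u A < i" for u
    proof -
      \<comment> \<open>Beyond \<open>v\<close> all of \<open>A\<close> is counted. Below
        \<open>v\<close>, minimality of the cut supplies the bound with \<open>k\<close> alone,
        where membership of \<open>M\<close> gives only \<open>k + l\<close>.\<close>
      have "u < v"
      proof (rule ccontr)
        assume "\<not> u < v"
        then have "count_le u A = size A" by (subst count_le_eq_size_iff) (auto simp: A_def)
        then show False using lt szA by simp
      qed
      moreover from this have "count_le u M = count_le u A"
        using count_le_shift_values_0[OF posB, of u v] join count_le_union[of u A "shift_values v B"] by simp
      ultimately show ?thesis using less_cut[of u r k M] v_def by simp
    qed
    moreover have "\<forall>p\<in>#A. fst p \<ge> 1" using M by (auto simp: A_def coloured_parking_def)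
    ultimately show ?thesis by (simp add: coloured_parking_def szA)
  qed
  moreover have "B \<in> coloured_parking r l (n - i)"
  proof -
    have "u < l + r * count_le u B" if lt: "count_le u B < n - i" for u
    proof -
      \<comment> \<open>Conversely, the condition for \<open>M\<close> at \<open>v + u\<close>
        becomes the condition for \<open>B\<close> at \<open>u\<close> after cancelling
        \<open>v = k + r * i\<close>.\<close>
      have "count_le (v + u) A = size A" by (subst count_le_eq_size_iff) (auto simp: A_def)
      then have c: "count_le (v + u) M = i + count_le u B"
        using join count_le_union[of "v + u" A "shift_values v B"] szA
        by (simp only: count_le_shift_values)
      then have "count_le (v + u) M < n" using lt by simp
      then have "v + u < k + l + r * count_le (v + u) M" using M by (simp add: coloured_parking_def)
      then show ?thesis unfolding c using v by (simp add: algebra_simps)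
    qed
    then show ?thesis using posB by (simp add: coloured_parking_def szB)
  qed
  ultimately show thesis using that i join v by blast
qed

section \<open>The bijection and the product formula\<close>

lemma bij_betw_coloured_parking:
  "bij_betw (\<lambda>(i, A, B). A + shift_values (k + r * i) B)
     (SIGMA i:{0..n}. coloured_parking r k i \<times> coloured_parking r l (n - i))
     (coloured_parking r (k + l) n)"
  (is "bij_betw ?f ?S ?T")
  unfolding bij_betw_def
proof
  show "inj_on ?f ?S"
  proof (rule inj_onI)
    fix x x' assume "x \<in> ?S" "x' \<in> ?S" and f: "?f x = ?f x'"
    then obtain i A B i' A' B' where x: "x = (i, A, B)" "x' = (i', A', B')"
      and A: "A \<in> coloured_parking r k i" and B: "B \<in> coloured_parking r l (n - i)"
      and A': "A' \<in> coloured_parking r k i'" and B': "B' \<in> coloured_parking r l (n - i')"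
      by blast
    have eq: "A + shift_values (k + r * i) B = A' + shift_values (k + r * i') B'"
      using f unfolding x by simp
    \<comment> \<open>Both sides are the cut of the same multiset. This aligns the filters and
      shifts; \<open>i = i'\<close> itself follows at the end from the size of
      \<open>A\<close>.\<close>
    have v: "k + r * i = k + r * i'"
      using coloured_parking_join(2)[OF A B] coloured_parking_join(2)[OF A' B'] unfolding eq by linarith
    have "A = A'"
      using coloured_parking_join(3)[OF A B] coloured_parking_join(3)[OF A' B']
      unfolding eq unfolding v by (rule trans[OF sym])
    moreover have "shift_values (k + r * i) B = shift_values (k + r * i) B'"
      using coloured_parking_join(4)[OF A B] coloured_parking_join(4)[OF A' B']
      unfolding eq unfolding v by (rule trans[OF sym])
    moreover have "inj (map_prod (\<lambda>x. x + (k + r * i)) (id :: nat \<Rightarrow> nat))"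
      by (intro prod.inj_map) (auto simp: inj_def)
    ultimately have "A = A'" "B = B'"
      using multiset.inj_map by (auto dest: injD)
    then show "x = x'"
      using A A' by (simp add: x coloured_parking_def)
  qed
  show "?f ` ?S = ?T"
  proof
    show "?f ` ?S \<subseteq> ?T"
    proof clarify
      fix i A B
      assume "i \<in> {0..n}" "A \<in> coloured_parking r k i" "B \<in> coloured_parking r l (n - i)"
      then show "A + shift_values (k + r * i) B \<in> ?T"
        using coloured_parking_join(1)[of A r k i B l "n - i"] by simp
    qed
    show "?T \<subseteq> ?f ` ?S"
    proof
      fix M assume "M \<in> ?T"
      then obtain i A B where "i \<le> n" "A \<in> coloured_parking r k i"
        "B \<in> coloured_parking r l (n - i)" "M = A + shift_values (k + r * i) B"
        by (rule coloured_parking_split)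
      then show "M \<in> ?f ` ?S" by (intro image_eqI[of _ _ "(i, A, B)"]) auto
    qed
  qed
qed

text \<open>The coefficients of \<open>t^n\<close> on both sides enumerate corresponding objects:
  shifting moves values only, so the colour weights of the two parts add up to that of their
  join.\<close>

lemma parking_series_add: "parking_series r k * parking_series r l = parking_series r (k + l)"
proof (rule fps_ext)
  fix n
  let ?S = "SIGMA i:{0..n}. coloured_parking r k i \<times> coloured_parking r l (n - i)"
  have "enumerates (\<Sum>i=0..n. parking_frob r k i * parking_frob r l (n - i)) ?S
      (\<lambda>(i, p). (case p of (A, B) \<Rightarrow> image_mset snd A + image_mset snd B))"
    by (intro enumerates_sum enumerates_times enumerates_parking_frob) simp
  then have "enumerates (\<Sum>i=0..n. parking_frob r k i * parking_frob r l (n - i))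
      (coloured_parking r (k + l) n) (image_mset snd)"
    using bij_betw_coloured_parking
    by (rule enumerates_bij_betw) (auto simp: image_mset.compositionality o_def)
  then have "(\<Sum>i=0..n. parking_frob r k i * parking_frob r l (n - i)) = parking_frob r (k + l) n"
    using enumerates_parking_frob enumerates_unique by blast
  then show "fps_nth (parking_series r k * parking_series r l) n = fps_nth (parking_series r (k + l)) n"
    by (simp add: parking_series_def fps_mult_nth)
qed

theorem theorem3p1:
  fixes k r :: nat
  assumes "k > 0" and "r > 0"
  shows "parking_series r 1 ^ k = parking_series r k"
  using assms(1)
proof (induction k rule: nat_induct_non_zero)
  case 1
  show ?case by simp
next
  case (Suc k)
  then show ?case using parking_series_add[of r 1 k] by simp
qed

end
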